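(* Fix $m\in(0,1/2]$. Then the discrete Coagulation-Fragmentation equation with kernels $a(j,k)=jk$ and $b(j,k)=1$ admits a unique stationary solution $\tilde\rho:\mathbb{N}\to[0,\infty)$ such that $m_1(\tilde\rho)=\sum_{l=1}^\infty l\tilde\rho(l)=m$. Further, for $l\in\mathbb{N}$, $$\tilde\rho(l)=\frac{2m(1-m)}{(2m+1)l+1}+\frac{1}{(2m+1)l+1}\left(\sum_{i=1}^{l-1}i(l-i)\tilde\rho(i)\tilde\rho(l-i)-2\sum_{i=1}^{l-1}\tilde\rho(i)\right).$$
   Context: Here $\mathbb{N}=\{1,2,3,\dots\}$; empty sums are $0$. The discrete Coagulation-Fragmentation equation with kernels $a(j,k)=jk$, $b(j,k)=1$ is, for $j\in\mathbb{N}$, $t>0$, $$\rho_t(j,t)=\frac12\sum_{k=1}^{j-1}(j-k)k\,\rho(j-k,t)\rho(k,t)-\rho(j,t)\sum_{k=1}^\infty jk\,\rho(k,t)-\frac12(j-1)\rho(j,t)+\sum_{k=1}^\infty\rho(j+k,t).$$ A function $\rho:\mathbb{N}\times[0,\infty)\to[0,\infty)$ is called a solution if for every bounded $g:\mathbb{N}\to\mathbb{R}$, $$\frac{d}{dt}\sum_{j=1}^\infty g(j)\rho(j,t)=\frac12\sum_{j=1}^\infty\sum_{k=1}^\infty\big(g(j+k)-g(j)-g(k)\big)jk\,\rho(j,t)\rho(k,t)-\frac12\sum_{j=1}^\infty\sum_{k=1}^{j-1}\big(g(j)-g(k)-g(j-k)\big)\rho(j,t).$$ A stationary solution is a function $\tilde\rho:\mathbb{N}\to[0,\infty)$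 such that $\rho(j,t)=\tilde\rho(j)$ is a (time-independent) solution. *)

theory Defs
  imports "HOL-Analysis.Analysis"
begin

text \<open>
  The index set $\{1,2,3,\dots\}$ is the set \<^term>\<open>{1..} :: nat set\<close>; values at index 0 never
  enter the definitions below.
\<close>

definition coag_term :: "(nat \<Rightarrow> real) \<Rightarrow> (nat \<Rightarrow> real) \<Rightarrow> nat \<Rightarrow> nat \<Rightarrow> real" where
  "coag_term g r j k = (g (j + k) - g j - g k) * (real j * real k) * r j * r k"

definition frag_term :: "(nat \<Rightarrow> real) \<Rightarrow> (nat \<Rightarrow> real) \<Rightarrow> nat \<Rightarrow> real" where
  "frag_term g r j = (\<Sum>k=1..<j. (g j - g k - g (j - k)) * r j)"

text \<open>
  \<^term>\<open>infsum\<close> is 0 on families that are not summable, so convergence of every series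
  in the weak formulation is demanded explicitly.
\<close>

definition weak_sums_converge :: "(nat \<Rightarrow> real) \<Rightarrow> (nat \<Rightarrow> real) \<Rightarrow> bool" where
  "weak_sums_converge g r \<longleftrightarrow>
     (\<lambda>j. g j * r j) summable_on {1..} \<and>
     (\<forall>j\<ge>1. coag_term g r j summable_on {1..}) \<and>
     (\<lambda>j. \<Sum>\<^sub>\<infinity>k\<in>{1..}. coag_term g r j k) summable_on {1..} \<and>
     frag_term g r summable_on {1..}"

definition weak_rhs :: "(nat \<Rightarrow> real) \<Rightarrow> (nat \<Rightarrow> real) \<Rightarrow> real" where
  "weak_rhs g r =
     1/2 * (\<Sum>\<^sub>\<infinity>j\<in>{1..}. \<Sum>\<^sub>\<infinity>k\<in>{1..}. coag_term g r j k)
   - 1/2 * (\<Sum>\<^sub>\<infinity>j\<in>{1..}. frag_term g r j)"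

definition CF_solution :: "(nat \<Rightarrow> real \<Rightarrow> real) \<Rightarrow> bool" where
  "CF_solution \<rho> \<longleftrightarrow>
     (\<forall>j\<ge>1. \<forall>t\<ge>0. \<rho> j t \<ge> 0) \<and>
     (\<forall>g. bounded (g ` {1..}) \<longrightarrow>
        (\<forall>t>0. weak_sums_converge g (\<lambda>j. \<rho> j t) \<and>
          ((\<lambda>s. \<Sum>\<^sub>\<infinity>j\<in>{1..}. g j * \<rho> j s) has_real_derivative
             weak_rhs g (\<lambda>j. \<rho> j t)) (at t)))"

text \<open>
  Functions from $\{1,2,\dots\}$ to $[0,\infty)$ are the elements of the extensional function space,
  so that equality of stationary solutions means equality on $\{1,2,\dots\}$.
\<close>

definition stationary_CF_solution :: "(nat \<Rightarrow> real) \<Rightarrow> bool" where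
  "stationary_CF_solution r \<longleftrightarrow>
     r \<in> {1..} \<rightarrow>\<^sub>E {0..} \<and> CF_solution (\<lambda>j t. r j)"

definition has_first_moment :: "(nat \<Rightarrow> real) \<Rightarrow> real \<Rightarrow> bool" where
  "has_first_moment r m \<longleftrightarrow> ((\<lambda>l. real l * r l) has_sum m) {1..}"

end

theory Submission
  imports Defs
begin

text \<open>
  Put $T_l = m_0 - \sum_{i \le l} \rho(i)$ and $C_l = \sum_{i<l} i(l-i)\rho(i)\rho(l-i)$. Testing the
  weak equation with indicator functions gives $((2m+1)l-1)\,\rho(l) = C_l + 2T_l$ for all $l$,
  a recursion that determines $\rho$ from $m_0$. Summing it over $l$ yields $M^2 + (1-2m)M = m_0$
  for the first moment $M$, hence $m_0 = m(1-m)$ if $M = m$; conversely, $m_0 = m(1-m)$ leaves only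
  $M = m$ or $M = m - 1 < 0$.

  For existence it remains to see that the recursion started with $m_0 = m(1-m)$ has nonnegative tails
  $T_l$. Treat $m_0 = s$ as a parameter: for small $s$ the recursion is nearly linear and all tails
  are positive. If $T_n$ vanishes for some $s$, then $\rho$ restricted to $\{1,\dots,n\}$
  solves a closed finite system whose second moment identity reads
  $\sum_j j^2\rho(j)B_j = m \sum_j j^2 \rho(j)$ with $B_j = \sum_{k \le n-j} k\rho(k)$. Since $B$ is
  decreasing, this gives $M \ge m$ and, by Chebyshev's sum inequality,
  $\sum_{l \le n} C_l = \sum_j j\rho(j)B_j \ge mM$, so that
  $s = (1-2m)M + \sum_{l \le n} C_l \ge (1-m)M \ge m(1-m)$. Hence no tail changes sign before $s$ reaches $m(1-m)$.
\<close>

section \<open>Convolution sums and tails\<close>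

text \<open>The convolution square of the sequence i r(i), which is twice the coagulation gain at
  size \<open>l\<close>.\<close>

definition conv :: "(nat \<Rightarrow> real) \<Rightarrow> nat \<Rightarrow> real" where
  "conv r l = (\<Sum>i=1..<l. real i * real (l - i) * r i * r (l - i))"

text \<open>The total \<open>s\<close> is formal and need not be the sum of \<open>r\<close>. So
  tails make sense before convergence is known and for finite truncations.\<close>

definition tail :: "real \<Rightarrow> (nat \<Rightarrow> real) \<Rightarrow> nat \<Rightarrow> real" where
  "tail s r l = s - (\<Sum>i=1..l. r i)"

lemma tail_0 [simp]: "tail s r 0 = s"
  by (simp add: tail_def)

lemma tail_Suc: "tail s r (Suc n) = tail s r n - r (Suc n)"
  by (simp add: tail_def)

text \<open>Each tail at l <= n is the tail at \<open>n\<close> plus the values with index in (l,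
  n], and r(i) is counted once for each of the i - 1 indices l < i.\<close>

lemma sum_tail:
  "(\<Sum>l=1..n. tail s r l) = (\<Sum>i=1..n. (real i - 1) * r i) + real n * tail s r n"
  by (induction n) (auto simp: tail_Suc algebra_simps)

text \<open>Same count with weight l: the indices l < i add up to i(i - 1)/2.\<close>

lemma sum_index_tail:
  "2 * (\<Sum>l=1..n. real l * tail s r l) =
     (\<Sum>i=1..n. real i * (real i - 1) * r i) + real n * (real n + 1) * tail s r n"
  by (induction n) (auto simp: tail_Suc algebra_simps)

text \<open>Both sides run over the pairs of positive integers with sum at most \<open>n\<close>, on
  the left diagonal by diagonal.\<close>

lemma sum_triangle:
  fixes h :: "nat \<Rightarrow> nat \<Rightarrow> real"
  shows "(\<Sum>l=1..n. \<Sum>i=1..<l. h i (l - i)) = (\<Sum>j=1..n. \<Sum>k=1..n - j. h j k)"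
  unfolding sum.Sigma[OF finite_atLeastAtMost ballI[OF finite_atLeastLessThan]]
    sum.Sigma[OF finite_atLeastAtMost ballI[OF finite_atLeastAtMost]]
  by (rule sum.reindex_bij_witness[where i = "\<lambda>(j, k). (j + k, j)" and j = "\<lambda>(l, i). (i, l - i)"])
    auto

lemma sum_weight_conv:
  "(\<Sum>l=1..n. \<phi> l * conv r l) =
     (\<Sum>j=1..n. \<Sum>k=1..n - j. \<phi> (j + k) * (real j * r j * (real k * r k)))"
proof -
  have "(\<Sum>l=1..n. \<phi> l * conv r l) =
      (\<Sum>l=1..n. \<Sum>i=1..<l. \<phi> (i + (l - i)) * (real i * r i * (real (l - i) * r (l - i))))"
    by (simp add: conv_def sum_distrib_left algebra_simps)
  also have "\<dots> = (\<Sum>j=1..n. \<Sum>k=1..n - j. \<phi> (j + k) * (real j * r j * (real k * r k)))"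
    by (rule sum_triangle)
  finally show ?thesis .
qed

lemma sum_triangle_commute:
  fixes h :: "nat \<Rightarrow> nat \<Rightarrow> real"
  shows "(\<Sum>j=1..n. \<Sum>k=1..n - j. h j k) = (\<Sum>j=1..n. \<Sum>k=1..n - j. h k j)"
  unfolding sum.Sigma[OF finite_atLeastAtMost ballI[OF finite_atLeastAtMost]]
  by (rule sum.reindex_bij_witness[where i = prod.swap and j = prod.swap]) auto

lemma sum_conv:
  "(\<Sum>l=1..n. conv r l) = (\<Sum>j=1..n. real j * r j * (\<Sum>k=1..n - j. real k * r k))"
  using sum_weight_conv[of "\<lambda>_. 1" r n] by (simp add: sum_distrib_left)

text \<open>On the diagonal l = j + k the weight splits into j and k, which contribute equally by
  symmetry of the triangle.\<close>

lemma sum_index_conv: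
  "(\<Sum>l=1..n. real l * conv r l) =
     2 * (\<Sum>j=1..n. (real j)\<^sup>2 * r j * (\<Sum>k=1..n - j. real k * r k))"
proof -
  let ?h = "\<lambda>j k. real j * (real j * r j * (real k * r k))"
  have "(\<Sum>l=1..n. real l * conv r l) =
      (\<Sum>j=1..n. \<Sum>k=1..n - j. ?h j k) + (\<Sum>j=1..n. \<Sum>k=1..n - j. ?h k j)"
    by (subst sum_weight_conv) (simp add: sum.distrib[symmetric] algebra_simps)
  also have "\<dots> = 2 * (\<Sum>j=1..n. \<Sum>k=1..n - j. ?h j k)"
    by (subst (2) sum_triangle_commute) simp
  finally show ?thesis
    by (simp add: sum_distrib_left power2_eq_square mult.assoc)
qed

section \<open>The stationary recursion and its moment identities\<close>

text \<open>Twice the stationary strong equation at size \<open>l\<close>, with \<open>m\<close> in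
  place of the first moment and \<open>s\<close> in place of the zeroth. Keeping both as free
  parameters lets the same predicate describe finite systems.\<close>

definition balanced :: "real \<Rightarrow> real \<Rightarrow> (nat \<Rightarrow> real) \<Rightarrow> nat \<Rightarrow> bool" where
  "balanced m s r l \<longleftrightarrow> ((2 * m + 1) * real l - 1) * r l = conv r l + 2 * tail s r l"

lemma balanced_sum:
  assumes "\<And>l. l \<in> {1..n} \<Longrightarrow> balanced m s r l"
  shows "2 * real n * tail s r n =
    (2 * m - 1) * (\<Sum>l=1..n. real l * r l) + (\<Sum>l=1..n. r l) - (\<Sum>l=1..n. conv r l)"
proof -
  have "(\<Sum>l=1..n. ((2 * m + 1) * real l - 1) * r l) = (\<Sum>l=1..n. conv r l + 2 * tail s r l)"
    using assms by (intro sum.cong) (auto simp: balanced_def)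
  also have "\<dots> = (\<Sum>l=1..n. conv r l)
      + 2 * ((\<Sum>i=1..n. (real i - 1) * r i) + real n * tail s r n)"
    unfolding sum.distrib sum_distrib_left[symmetric] sum_tail ..
  also have "(\<Sum>i=1..n. (real i - 1) * r i) = (\<Sum>i=1..n. real i * r i) - (\<Sum>i=1..n. r i)"
    by (simp add: left_diff_distrib sum_subtractf)
  also have "(\<Sum>l=1..n. ((2 * m + 1) * real l - 1) * r l) =
      (2 * m + 1) * (\<Sum>l=1..n. real l * r l) - (\<Sum>l=1..n. r l)"
    by (simp add: left_diff_distrib sum_subtractf sum_distrib_left mult.assoc)
  finally show ?thesis
    by (simp add: algebra_simps)
qed

text \<open>With weight l the first moments on the two sides cancel, so only the second moment, the
  convolution and a boundary term remain.\<close>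

lemma balanced_sum_index:
  assumes "\<And>l. l \<in> {1..n} \<Longrightarrow> balanced m s r l"
  shows "2 * m * (\<Sum>l=1..n. (real l)\<^sup>2 * r l) =
    (\<Sum>l=1..n. real l * conv r l) + real n * (real n + 1) * tail s r n"
proof -
  have "(\<Sum>l=1..n. real l * (((2 * m + 1) * real l - 1) * r l)) =
      (\<Sum>l=1..n. real l * (conv r l + 2 * tail s r l))"
    using assms by (intro sum.cong) (auto simp: balanced_def)
  also have "\<dots> = (\<Sum>l=1..n. real l * conv r l) + 2 * (\<Sum>l=1..n. real l * tail s r l)"
    by (simp add: sum.distrib sum_distrib_left algebra_simps)
  finally show ?thesis
    unfolding sum_index_tail
    by (simp add: algebra_simps sum.distrib sum_subtractf sum_distrib_left power2_eq_square)
qed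

section \<open>Vanishing tails force a large total\<close>

text \<open>Expand the nonpositive double sum of w(i) w(j) (x(i) - x(j)) (y(i) - y(j)); each product
  of sums occurs twice.\<close>

lemma chebyshev_sum_weighted:
  fixes w x y :: "'a \<Rightarrow> real"
  assumes "\<And>i. i \<in> A \<Longrightarrow> 0 \<le> w i"
    and "\<And>i j. i \<in> A \<Longrightarrow> j \<in> A \<Longrightarrow> (x i - x j) * (y i - y j) \<le> 0"
  shows "(\<Sum>i\<in>A. w i) * (\<Sum>i\<in>A. w i * x i * y i) \<le> (\<Sum>i\<in>A. w i * x i) * (\<Sum>i\<in>A. w i * y i)"
proof -
  have "0 \<ge> (\<Sum>i\<in>A. \<Sum>j\<in>A. w i * w j * ((x i - x j) * (y i - y j)))"
    using assms by (intro sum_nonpos mult_nonneg_nonpos[OF mult_nonneg_nonneg])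
  also have "(\<Sum>i\<in>A. \<Sum>j\<in>A. w i * w j * ((x i - x j) * (y i - y j))) =
      (\<Sum>i\<in>A. \<Sum>j\<in>A. (w i * x i * y i) * w j) + (\<Sum>i\<in>A. \<Sum>j\<in>A. w i * (w j * x j * y j))
      - (\<Sum>i\<in>A. \<Sum>j\<in>A. (w i * x i) * (w j * y j)) - (\<Sum>i\<in>A. \<Sum>j\<in>A. (w i * y i) * (w j * x j))"
    unfolding sum.distrib[symmetric] sum_subtractf[symmetric]
    by (intro sum.cong refl) (simp add: algebra_simps)
  finally show ?thesis
    unfolding sum_product[symmetric] by (simp add: mult.commute)
qed

lemma tail_eq_0_imp_large:
  assumes bal: "\<And>l. l \<in> {1..n} \<Longrightarrow> balanced m s r l"
    and nn: "\<And>l. l \<in> {1..n} \<Longrightarrow> 0 \<le> r l"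
    and m: "0 < m" "m < 1" and s: "0 < s" and tail: "tail s r n = 0"
  shows "m * (1 - m) \<le> s"
proof -
  define M where "M = (\<Sum>l=1..n. real l * r l)"
  define M2 where "M2 = (\<Sum>l=1..n. (real l)\<^sup>2 * r l)"
  define B where "B = (\<lambda>j. \<Sum>k=1..n - j. real k * r k)"
  have sum_r: "(\<Sum>l=1..n. r l) = s"
    using tail by (simp add: tail_def)
  \<comment> \<open>This makes \<open>M2\<close> positive, so that it can be cancelled in both
    comparisons below.\<close>
  have "s \<le> M2"
    unfolding sum_r[symmetric] M2_def
  proof (intro sum_mono)
    fix l assume l: "l \<in> {1..n}"
    then have "1 * r l \<le> (real l)\<^sup>2 * r l"
      using nn by (intro mult_right_mono) auto
    then show "r l \<le> (real l)\<^sup>2 * r l" by simp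
  qed
  with s have M2: "0 < M2" by simp
  have B_mono: "B j \<le> B i" if "i \<le> j" for i j
    unfolding B_def using that nn by (intro sum_mono2) auto
  \<comment> \<open>The boundary term of \<open>balanced_sum_index\<close> vanishes with the tail,
    and the factors 2 cancel.\<close>
  have second: "(\<Sum>j=1..n. (real j)\<^sup>2 * r j * B j) = m * M2"
    using balanced_sum_index[of n m s r] bal tail unfolding sum_index_conv M2_def B_def by simp
  have "(\<Sum>j=1..n. (real j)\<^sup>2 * r j * B j) \<le> (\<Sum>j=1..n. (real j)\<^sup>2 * r j * M)"
    using B_mono[of 0] nn by (intro sum_mono mult_left_mono) (auto simp: B_def M_def)
  also have "\<dots> = M * M2"
    by (simp add: M2_def sum_distrib_left mult_ac)
  finally have mM: "m \<le> M"
    using second M2 by (simp add: mult_le_cancel_right)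
  \<comment> \<open>Chebyshev with weights j r(j), the increasing sequence j and the decreasing
    sequence \<open>B\<close>.\<close>
  have "M * (\<Sum>j=1..n. real j * r j * real j * B j) \<le>
      (\<Sum>j=1..n. real j * r j * real j) * (\<Sum>j=1..n. real j * r j * B j)"
    unfolding M_def
  proof (rule chebyshev_sum_weighted)
    show "(real i - real j) * (B i - B j) \<le> 0" for i j
      using B_mono[of i j] B_mono[of j i]
      by (cases "i \<le> j") (auto intro: mult_nonneg_nonpos mult_nonpos_nonneg)
  qed (use nn in auto)
  moreover have "(\<Sum>j=1..n. real j * r j * real j * B j) = m * M2"
    "(\<Sum>j=1..n. real j * r j * real j) = M2"
    using second by (simp_all add: M2_def power2_eq_square mult_ac)
  ultimately have "M2 * (m * M) \<le> M2 * (\<Sum>j=1..n. real j * r j * B j)"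
    by (simp add: mult_ac)
  with M2 have "m * M \<le> (\<Sum>l=1..n. conv r l)"
    unfolding sum_conv B_def by (simp add: mult_le_cancel_left)
  also have "\<dots> = (2 * m - 1) * M + s"
    using balanced_sum[of n m s r] bal tail sum_r by (simp add: M_def)
  finally have "(1 - m) * M \<le> s"
    by (simp add: algebra_simps)
  moreover have "(1 - m) * m \<le> (1 - m) * M"
    using mM m by (intro mult_left_mono) auto
  ultimately show ?thesis
    by (simp add: mult.commute)
qed

section \<open>The explicit recursion and its dependence on the total\<close>

text \<open>The tail at \<open>l\<close> still contains r(l). Moving this part to the left turns the
  coefficient's -1 into +1 and leaves only earlier values on the right.\<close>

lemma balanced_iff:
  assumes "1 \<le> l" "0 < m"
  shows "balanced m s r l \<longleftrightarrow> r l = (2 * tail s r (l - 1) + conv r l) / ((2 * m + 1) * real l + 1)"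
proof -
  have "(2 * m + 1) * real l + 1 > 0"
    using assms by (intro add_nonneg_pos) auto
  moreover have "tail s r l = tail s r (l - 1) - r l"
    using assms tail_Suc[of s r "l - 1"] by simp
  ultimately show ?thesis
    by (auto simp: balanced_def field_simps)
qed

text \<open>The solution of the recursion divided by its total \<open>s\<close>. Without this
  scaling it would vanish identically at s = 0 and the tails would have no sign there; after
  scaling, the quadratic term carries a factor \<open>s\<close> and the recursion at s = 0 is
  linear.\<close>

function scaled_sol :: "real \<Rightarrow> real \<Rightarrow> nat \<Rightarrow> real" where
  "scaled_sol m s l =
     (2 * (1 - (\<Sum>i=1..<l. scaled_sol m s i))
      + s * (\<Sum>i=1..<l. real i * real (l - i) * scaled_sol m s i * scaled_sol m s (l - i)))
     / ((2 * m + 1) * real l + 1)"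
  by auto
termination
  by (relation "Wellfounded.measure (\<lambda>(m, s, l). l)") auto

declare scaled_sol.simps [simp del]

lemma continuous_on_scaled_sol: "continuous_on S (\<lambda>s. scaled_sol m s l)"
proof (induction l rule: less_induct)
  case (less l)
  show ?case
    \<comment> \<open>A vanishing denominator makes the quotient the constant 0.\<close>
    by (subst scaled_sol.simps, cases "(2 * m + 1) * real l + 1 = 0")
      (use less in \<open>auto intro!: continuous_intros\<close>)
qed

lemma atLeastLessThan_eq_pred: "Suc 0 \<le> l \<Longrightarrow> {Suc 0..<l} = {Suc 0..l - Suc 0}"
  by auto

lemma balanced_scaled_sol:
  assumes "1 \<le> l" "0 < m"
  shows "balanced m s (\<lambda>l. s * scaled_sol m s l) l"
  using assms
  by (simp add: balanced_iff, subst scaled_sol.simps)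
    (simp add: conv_def tail_def atLeastLessThan_eq_pred sum_distrib_left algebra_simps)

lemma tail_scaled: "tail s (\<lambda>l. s * q l) l = s * tail 1 q l"
  by (simp add: tail_def sum_distrib_left algebra_simps)

section \<open>Signs of the tails\<close>

text \<open>Passing from l to l + 1 multiplies the tail by 1 - 2/((2m + 1)(l + 1) + 1), which is
  positive because (2m + 1)(l + 1) > 1.\<close>

lemma tail_scaled_sol_at_0:
  assumes "0 < m"
  shows "0 < tail 1 (scaled_sol m 0) l"
proof (induction l)
  case (Suc l)
  have pos: "(2 * m + 1) * real (Suc l) + 1 > 0"
    using assms by (intro add_nonneg_pos) auto
  have "1 < (2 * m + 1) * real (Suc l)"
    using assms by (intro less_1_mult'[of "2*m+1" "real (Suc l)"]) auto
  moreover have "scaled_sol m 0 (Suc l) = 2 * tail 1 (scaled_sol m 0) l / ((2 * m + 1) * real (Suc l) + 1)"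
    by (subst scaled_sol.simps) (simp add: tail_def atLeastLessThanSuc_atLeastAtMost)
  ultimately show ?case
    using Suc pos unfolding tail_Suc by (simp add: pos_divide_less_eq del: of_nat_Suc)
qed auto

text \<open>The numerator of the recursion is twice the tail at l - 1 plus a nonnegative multiple of
  products of earlier values, so tails strictly before \<open>l\<close> suffice.\<close>

lemma scaled_sol_nonneg:
  assumes "0 < m" "0 \<le> s" "\<And>i. i < l \<Longrightarrow> 0 \<le> tail 1 (scaled_sol m s) i" "1 \<le> l"
  shows "0 \<le> scaled_sol m s l"
  using assms(3,4)
proof (induction l rule: less_induct)
  case (less l)
  have "0 \<le> tail 1 (scaled_sol m s) (l - 1)"
    using less.prems by auto
  then have "0 \<le> 1 - (\<Sum>i=1..<l. scaled_sol m s i)"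
    using less.prems by (simp add: tail_def atLeastLessThan_eq_pred)
  moreover have "0 \<le> scaled_sol m s i" if "i \<in> {1..<l}" for i
    using that less by auto
  then have "0 \<le> s * (\<Sum>i=1..<l. real i * real (l - i) * scaled_sol m s i * scaled_sol m s (l - i))"
    using assms by (intro mult_nonneg_nonneg sum_nonneg) auto
  ultimately show ?case
    using assms by (subst scaled_sol.simps) auto
qed

text \<open>
  Continuity in \<^term>\<open>s\<close>: a tail that is positive at 0 could change sign only through a zero,
  which \<open>tail_eq_0_imp_large\<close> excludes below \<^term>\<open>m * (1 - m)\<close>.
\<close>

lemma tail_scaled_sol_pos:
  assumes m: "0 < m" "m < 1" and s: "0 \<le> s" "s < m * (1 - m)"
  shows "0 < tail 1 (scaled_sol m s) l"
  using s
proof (induction l arbitrary: s rule: less_induct)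
  case (less l)
  show ?case
  proof (rule ccontr)
    assume "\<not> ?thesis"
    then have "tail 1 (scaled_sol m s) l \<le> 0" by simp
    moreover have "0 \<le> tail 1 (scaled_sol m 0) l"
      using tail_scaled_sol_at_0 m less_imp_le by blast
    moreover have "continuous_on {0..s} (\<lambda>s. tail 1 (scaled_sol m s) l)"
      unfolding tail_def by (intro continuous_intros continuous_on_scaled_sol)
    ultimately obtain t where t: "0 \<le> t" "t \<le> s" "tail 1 (scaled_sol m t) l = 0"
      using IVT2'[of "\<lambda>s. tail 1 (scaled_sol m s) l" s 0 0] less.prems by auto
    \<comment> \<open>A positive \<open>t\<close> is required as the total in
      \<open>tail_eq_0_imp_large\<close>.\<close>
    have "t \<noteq> 0"
      using t tail_scaled_sol_at_0[OF m(1), of l] by auto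
    with t have "0 < t" by simp
    \<comment> \<open>The induction hypothesis covers every parameter below m(1 - m), so it applies
      at \<open>t\<close>; it yields nonnegative values up to \<open>l\<close>.\<close>
    have pos: "0 < tail 1 (scaled_sol m t) i" if "i < l" for i
      using less.IH[OF that, of t] t less.prems by auto
    have "0 \<le> scaled_sol m t i" if "i \<in> {1..l}" for i
      using that t m pos by (intro scaled_sol_nonneg) (auto intro: less_imp_le)
    then have "m * (1 - m) \<le> t"
      using tail_eq_0_imp_large[of l m t "\<lambda>l. t * scaled_sol m t l"] m t \<open>0 < t\<close>
      by (simp add: balanced_scaled_sol tail_scaled)
    then show False
      using t less.prems by simp
  qed
qed

text \<open>Strict positivity for smaller totals passes to the limit from the left as a weak
  inequality.\<close>

lemma tail_scaled_sol_nonneg: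
  assumes m: "0 < m" "m < 1"
  shows "0 \<le> tail 1 (scaled_sol m (m * (1 - m))) l"
proof -
  let ?s = "m * (1 - m)"
  have "((\<lambda>s. tail 1 (scaled_sol m s) l) \<longlongrightarrow> tail 1 (scaled_sol m ?s) l) (at_left ?s)"
  proof -
    have "continuous_on UNIV (\<lambda>s. tail 1 (scaled_sol m s) l)"
      unfolding tail_def by (intro continuous_intros continuous_on_scaled_sol)
    then have "isCont (\<lambda>s. tail 1 (scaled_sol m s) l) ?s"
      by (simp add: continuous_on_eq_continuous_at)
    then show ?thesis
      by (simp add: isCont_def filterlim_at_split)
  qed
  moreover have "eventually (\<lambda>s. 0 \<le> tail 1 (scaled_sol m s) l) (at_left ?s)"
  proof -
    have "eventually (\<lambda>s. s \<in> {0<..<?s}) (at_left ?s)"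
      using m by (intro eventually_at_left_real) auto
    then show ?thesis
      by eventually_elim (auto intro!: less_imp_le[OF tail_scaled_sol_pos] simp: m)
  qed
  ultimately show ?thesis
    by (rule tendsto_lowerbound) simp
qed

section \<open>Partial sums and summability over the positive integers\<close>

lemma has_sum_imp_tendsto_sum:
  fixes f :: "nat \<Rightarrow> 'a::{comm_monoid_add, topological_space}"
  assumes "(f has_sum S) {1..}"
  shows "(\<lambda>n. \<Sum>i=1..n. f i) \<longlonglongrightarrow> S"
proof -
  have "filterlim (\<lambda>n. {1..n}) (finite_subsets_at_top {1..}) (at_top :: nat filter)"
    unfolding filterlim_iff
  proof (intro allI impI)
    fix P :: "nat set \<Rightarrow> bool"
    assume "eventually P (finite_subsets_at_top {1..})"
    then obtain X where X: "finite X" "X \<subseteq> {1..}"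
      and P: "\<And>Y. finite Y \<Longrightarrow> X \<subseteq> Y \<Longrightarrow> Y \<subseteq> {1..} \<Longrightarrow> P Y"
      unfolding eventually_finite_subsets_at_top by metis
    from X(1) obtain N where "X \<subseteq> {..N}"
      using finite_nat_iff_bounded_le by blast
    then have "P {1..n}" if "N \<le> n" for n
      using X that by (intro P) fastforce+
    then show "eventually (\<lambda>n. P {1..n}) sequentially"
      by (rule eventually_sequentiallyI)
  qed
  then show ?thesis
    using assms unfolding has_sum_def by (rule filterlim_compose[rotated])
qed

lemma nonneg_summable_on_bounded:
  fixes f :: "nat \<Rightarrow> real"
  assumes "\<And>i. 1 \<le> i \<Longrightarrow> 0 \<le> f i" "\<And>n. (\<Sum>i=1..n. f i) \<le> K"
  shows "f summable_on {1..}"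
proof (rule nonneg_bdd_above_summable_on)
  show "bdd_above (sum f ` {F. F \<subseteq> {1..} \<and> finite F})"
  proof (rule bdd_aboveI2)
    fix F assume F: "F \<in> {F. F \<subseteq> {1::nat..} \<and> finite F}"
    then obtain N where "F \<subseteq> {..N}"
      using finite_nat_iff_bounded_le by blast
    with F have "F \<subseteq> {1..N}" by auto
    then have "sum f F \<le> (\<Sum>i=1..N. f i)"
      using assms by (intro sum_mono2) auto
    also have "\<dots> \<le> K" by (rule assms)
    finally show "sum f F \<le> K" .
  qed
qed (use assms in auto)

section \<open>Moments of nonnegative solutions of the recursion\<close>

text \<open>The square of side \<open>n\<close> lies in the triangle j + k <= 2n, and the triangle j
  + k <= n lies in that square.\<close>

lemma sum_conv_bounds:
  assumes "\<And>l. 1 \<le> l \<Longrightarrow> 0 \<le> r l"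
  shows "(\<Sum>l=1..n. real l * r l)\<^sup>2 \<le> (\<Sum>l=1..2 * n. conv r l)"
    and "(\<Sum>l=1..n. conv r l) \<le> (\<Sum>l=1..n. real l * r l)\<^sup>2"
proof -
  let ?B = "\<lambda>n. \<Sum>k=1..n. real k * r k"
  have B: "?B i \<le> ?B j" if "i \<le> j" for i j
    using that assms by (intro sum_mono2) auto
  have B0: "0 \<le> ?B i" for i
    using assms by (intro sum_nonneg) auto
  have "(?B n)\<^sup>2 = (\<Sum>j=1..n. real j * r j * ?B n)"
    by (simp add: power2_eq_square sum_distrib_right)
  also have "\<dots> \<le> (\<Sum>j=1..n. real j * r j * ?B (2 * n - j))"
    using assms by (intro sum_mono mult_left_mono B) auto
  also have "\<dots> \<le> (\<Sum>j=1..2 * n. real j * r j * ?B (2 * n - j))"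
    using assms B0 by (intro sum_mono2) (auto intro!: mult_nonneg_nonneg)
  finally show "(?B n)\<^sup>2 \<le> (\<Sum>l=1..2 * n. conv r l)"
    by (simp only: sum_conv)
  have "(\<Sum>l=1..n. conv r l) \<le> (\<Sum>j=1..n. real j * r j * ?B n)"
    unfolding sum_conv using assms by (intro sum_mono mult_left_mono B) auto
  then show "(\<Sum>l=1..n. conv r l) \<le> (?B n)\<^sup>2"
    by (simp add: power2_eq_square sum_distrib_right)
qed

text \<open>
  The upper bound on \<^term>\<open>m\<close> makes the coefficient of the first moment in \<open>balanced_sum\<close>
  nonpositive, which bounds the first moment outright.
\<close>

lemma balanced_imp_moments:
  assumes bal: "\<And>l. 1 \<le> l \<Longrightarrow> balanced m s r l"
    and nn: "\<And>l. 1 \<le> l \<Longrightarrow> 0 \<le> r l"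
    and tail: "\<And>n. 0 \<le> tail s r n" and m: "m \<le> 1/2"
  obtains M where "(r has_sum s) {1..}" "has_first_moment r M" "0 \<le> M" "M\<^sup>2 + (1 - 2 * m) * M = s"
proof -
  let ?M = "\<lambda>n. \<Sum>l=1..n. real l * r l" and ?R = "\<lambda>n. \<Sum>l=1..n. r l"
    and ?C = "\<lambda>n. \<Sum>l=1..n. conv r l"
  have R_le: "?R n \<le> s" for n
    using tail[of n] by (simp add: tail_def)
  have M0: "0 \<le> ?M n" for n
    using nn by (intro sum_nonneg) auto
  have flux: "2 * real n * tail s r n = (2 * m - 1) * ?M n + ?R n - ?C n" for n
    using bal by (intro balanced_sum) auto
  \<comment> \<open>At 2n the left side of \<open>flux\<close> is nonnegative and its first-moment
    term nonpositive, so \<open>?C (2 * n)\<close> is at most \<open>?R (2 * n)\<close>, hence at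
    most \<open>s\<close>; the square of \<open>?M n\<close> lies below it.\<close>
  have "?M n \<le> sqrt s" for n
  proof (rule real_le_rsqrt)
    have "0 \<le> 2 * real (2 * n) * tail s r (2 * n)"
      using tail by simp
    moreover have "(2 * m - 1) * ?M (2 * n) \<le> 0"
      using m M0 by (intro mult_nonpos_nonneg) auto
    ultimately show "(?M n)\<^sup>2 \<le> s"
      using sum_conv_bounds(1)[of r n, OF nn] flux[of "2 * n"] R_le[of "2 * n"] by linarith
  qed
  then have "(\<lambda>l. real l * r l) summable_on {1..}"
    using nn by (intro nonneg_summable_on_bounded) auto
  then obtain M where M: "has_first_moment r M"
    by (auto simp: has_first_moment_def summable_on_def)
  have "r summable_on {1..}"
    using nn R_le by (intro nonneg_summable_on_bounded) auto
  then obtain S where S: "(r has_sum S) {1..}"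
    by (auto simp: summable_on_def)
  have M_lim: "?M \<longlonglongrightarrow> M"
    using M unfolding has_first_moment_def by (rule has_sum_imp_tendsto_sum)
  have R_lim: "?R \<longlonglongrightarrow> S"
    using S by (rule has_sum_imp_tendsto_sum)
  have sub: "filterlim (\<lambda>n::nat. 2 * n) at_top at_top"
    by (rule filterlim_subseq) (auto simp: strict_mono_def)
  have M2_lim: "(\<lambda>n. ?M (2 * n)) \<longlonglongrightarrow> M" and R2_lim: "(\<lambda>n. ?R (2 * n)) \<longlonglongrightarrow> S"
    using filterlim_compose[OF M_lim sub] filterlim_compose[OF R_lim sub] by simp_all
  \<comment> \<open>The bounds squeeze the convolution sums at 2n, which is why limits are taken
    along even indices.\<close>
  have C_lim: "(\<lambda>n. ?C (2 * n)) \<longlonglongrightarrow> M\<^sup>2"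
  proof (rule tendsto_sandwich)
    show "eventually (\<lambda>n. (?M n)\<^sup>2 \<le> ?C (2 * n)) sequentially"
      "eventually (\<lambda>n. ?C (2 * n) \<le> (?M (2 * n))\<^sup>2) sequentially"
      using nn by (auto intro!: always_eventually sum_conv_bounds simp del: One_nat_def)
  qed (intro tendsto_intros M_lim M2_lim)+
  have flux_lim: "(\<lambda>n. 2 * real (2 * n) * tail s r (2 * n)) \<longlonglongrightarrow> (2 * m - 1) * M + S - M\<^sup>2"
    unfolding flux by (intro tendsto_intros M2_lim R2_lim C_lim)
  have tail_lim: "(\<lambda>n. tail s r (2 * n)) \<longlonglongrightarrow> s - S"
    unfolding tail_def by (intro tendsto_intros R2_lim)
  \<comment> \<open>Since index times tail converges along even indices, the tail itself tends to 0
    there, so no mass is missing from the formal total.\<close>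
  have "(\<lambda>n. 2 * real (2 * n) * tail s r (2 * n) * (1 / real n)) \<longlonglongrightarrow>
      ((2 * m - 1) * M + S - M\<^sup>2) * 0"
    by (intro tendsto_mult flux_lim lim_1_over_n)
  moreover have "eventually (\<lambda>n. 2 * real (2 * n) * tail s r (2 * n) * (1 / real n) =
      4 * tail s r (2 * n)) sequentially"
    using eventually_gt_at_top[of 0] by eventually_elim simp
  ultimately have "(\<lambda>n. 4 * tail s r (2 * n)) \<longlonglongrightarrow> ((2 * m - 1) * M + S - M\<^sup>2) * 0"
    by (rule Lim_transform_eventually)
  moreover have "(\<lambda>n. 4 * tail s r (2 * n)) \<longlonglongrightarrow> 4 * (s - S)"
    by (intro tendsto_intros tail_lim)
  ultimately have "s = S"
    using LIMSEQ_unique by fastforce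
  \<comment> \<open>Now the tail is a true remainder, and n r(l) <= l r(l) for l > n. The bound is
    the remainder of the first moment series, so index times tail tends to 0 and the limit of
    \<open>flux\<close> is 0.\<close>
  have tail_le: "real n * tail s r n \<le> M - ?M n" for n
  proof (rule tendsto_le)
    show "(\<lambda>k. real n * (?R k - ?R n)) \<longlonglongrightarrow> real n * tail s r n"
      unfolding tail_def \<open>s = S\<close> by (intro tendsto_intros R_lim)
    show "(\<lambda>k. ?M k - ?M n) \<longlonglongrightarrow> M - ?M n"
      by (intro tendsto_intros M_lim)
    show "eventually (\<lambda>k. real n * (?R k - ?R n) \<le> ?M k - ?M n) sequentially"
      using eventually_ge_at_top[of n]
    proof eventually_elim
      case (elim k)
      \<comment> \<open>Stated for arbitrary \<open>h\<close> so that one fact rewrites both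
        differences of partial sums.\<close>
      have "f k - f n = (\<Sum>l=n+1..k. h l)" if "\<And>i. f i = (\<Sum>l=1..i. h l)" for f h :: "nat \<Rightarrow> real"
        using sum.ub_add_nat[of 1 n h "k - n"] elim by (simp add: that)
      note diff = this[OF refl]
      show ?case
        unfolding diff sum_distrib_left
        using nn by (intro sum_mono mult_right_mono) auto
    qed
  qed simp
  have "(\<lambda>n. real n * tail s r n) \<longlonglongrightarrow> 0"
  proof (rule tendsto_sandwich)
    show "eventually (\<lambda>n. 0 \<le> real n * tail s r n) sequentially"
      "eventually (\<lambda>n. real n * tail s r n \<le> M - ?M n) sequentially"
      using tail tail_le by (auto intro!: always_eventually simp del: One_nat_def)
    show "(\<lambda>n. M - ?M n) \<longlonglongrightarrow> 0"
      using tendsto_diff[OF tendsto_const[of M] M_lim] by simp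
  qed simp
  then have "(\<lambda>n. real (2 * n) * tail s r (2 * n)) \<longlonglongrightarrow> 0"
    by (rule filterlim_compose) (rule sub)
  then have "(\<lambda>n. 2 * real (2 * n) * tail s r (2 * n)) \<longlonglongrightarrow> 0"
    using tendsto_mult_left[of _ 0 sequentially "2::real"] by (simp only: mult.assoc mult_zero_right)
  with flux_lim have "(2 * m - 1) * M + S - M\<^sup>2 = 0"
    by (rule LIMSEQ_unique)
  then have "M\<^sup>2 + (1 - 2 * m) * M = s"
    using \<open>s = S\<close> by (simp add: algebra_simps)
  moreover have "0 \<le> M"
    using M_lim M0 by (intro LIMSEQ_le_const) auto
  ultimately show ?thesis
    using that M S \<open>s = S\<close> by blast
qed

section \<open>The weak formulation regrouped by the argument of the test function\<close>

lemma has_sum_tail: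
  fixes r :: "nat \<Rightarrow> real"
  assumes "(r has_sum s) {1..}"
  shows "(r has_sum tail s r n) {n<..}"
proof -
  have "(r has_sum (s - (\<Sum>i=1..n. r i))) ({1..} - {1..n})"
    using assms by (intro has_sum_Diff) (auto intro: has_sum_finite)
  moreover have "{1..} - {1..n} = {n<..}"
    by auto
  ultimately show ?thesis
    by (simp add: tail_def)
qed

text \<open>Regroup the double series along the diagonals j + k = l, each of which is
  finite.\<close>

lemma has_sum_conv:
  fixes g :: "nat \<Rightarrow> real"
  assumes "((\<lambda>(j, k). g (j + k) * (real j * r j * (real k * r k))) has_sum S) ({1..} \<times> {1..})"
  shows "((\<lambda>l. g l * conv r l) has_sum S) {1..}"
proof -
  have "((\<lambda>(l, i). g l * (real i * r i * (real (l - i) * r (l - i)))) has_sum S)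
      (Sigma {1..} (\<lambda>l. {1..<l}))"
    using assms
    by (subst has_sum_reindex_bij_witness[where S = "Sigma {1..} (\<lambda>l. {1..<l})"
          and i = "\<lambda>(j, k). (j + k, j)" and j = "\<lambda>(l, i). (i, l - i)" and T = "{1..} \<times> {1..}"
          and h = "\<lambda>(j, k). g (j + k) * (real j * r j * (real k * r k))" and s' = S]) auto
  then show ?thesis
    by (rule has_sum_SigmaD) (auto intro!: has_sum_finiteI simp: conv_def sum_distrib_left mult_ac)
qed

lemma summable_on_bounded_mult:
  fixes h f :: "'a \<Rightarrow> real"
  assumes "f summable_on A" "\<And>x. x \<in> A \<Longrightarrow> 0 \<le> f x" "\<And>x. x \<in> A \<Longrightarrow> \<bar>h x\<bar> \<le> K"
  shows "(\<lambda>x. h x * f x) summable_on A"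
proof (rule Infinite_Sum.abs_summable_summable, rule Infinite_Sum.abs_summable_on_comparison_test')
  show "(\<lambda>x. K * f x) summable_on A"
    using assms(1) by (rule summable_on_cmult_right)
  show "norm (h x * f x) \<le> K * f x" if "x \<in> A" for x
    using assms(2,3)[OF that] by (simp add: abs_mult mult_right_mono)
qed

lemma has_sum_diff:
  fixes f h :: "'a \<Rightarrow> real"
  assumes "(f has_sum a) A" "(h has_sum b) A"
  shows "((\<lambda>x. f x - h x) has_sum (a - b)) A"
  using has_sum_add[OF assms(1) has_sum_uminusI[OF assms(2)]] by simp

text \<open>The double series of j r(j) k r(k) converges with total m^2, so a bounded
  \<open>g\<close> allows splitting and rearranging. The gain is summed along diagonals; each of the
  two symmetric losses has inner sum \<open>m\<close>.\<close>

lemma has_sum_coag: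
  assumes mom: "has_first_moment r m" and nn: "\<And>l. 1 \<le> l \<Longrightarrow> 0 \<le> r l"
    and g: "\<And>l. 1 \<le> l \<Longrightarrow> \<bar>g l\<bar> \<le> K"
  obtains S where "((\<lambda>(j, k). coag_term g r j k) has_sum S) ({1..} \<times> {1..})"
    "((\<lambda>l. g l * conv r l - 2 * m * (g l * (real l * r l))) has_sum S) {1..}"
proof -
  let ?w = "\<lambda>j. real j * r j"
  let ?W = "\<lambda>p. ?w (fst p) * ?w (snd p)"
  have "?W summable_on {1..} \<times> {1..}"
  proof (rule summable_on_SigmaI)
    show "((\<lambda>k. ?W (j, k)) has_sum ?w j * m) {1..}" for j
      using has_sum_cmult_right[OF mom[unfolded has_first_moment_def]] by simp
    show "(\<lambda>j. ?w j * m) summable_on {1..}"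
      using has_sum_cmult_left[OF mom[unfolded has_first_moment_def]]
      by (auto simp: summable_on_def)
  qed (use nn in auto)
  moreover have "\<And>p. p \<in> {1..} \<times> {1..} \<Longrightarrow> 0 \<le> ?W p"
    using nn by auto
  ultimately have W: "?W summable_on {1..} \<times> {1..}" "\<And>p. p \<in> {1..} \<times> {1..} \<Longrightarrow> 0 \<le> ?W p"
    by blast+
  have "(\<lambda>p. g (fst p + snd p) * ?W p) summable_on {1..} \<times> {1..}"
    "(\<lambda>p. g (fst p) * ?W p) summable_on {1..} \<times> {1..}"
    by (intro summable_on_bounded_mult[OF W, where K = K] g; auto)+
  then obtain A B where A: "((\<lambda>p. g (fst p + snd p) * ?W p) has_sum A) ({1..} \<times> {1..})"
    and B: "((\<lambda>p. g (fst p) * ?W p) has_sum B) ({1..} \<times> {1..})"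
    by (auto simp: summable_on_def)
  have B': "((\<lambda>p. g (snd p) * ?W p) has_sum B) ({1..} \<times> {1..})"
    using B by (subst has_sum_swap) (simp add: case_prod_unfold mult.commute)
  have "((\<lambda>p. g (fst p + snd p) * ?W p - g (fst p) * ?W p - g (snd p) * ?W p) has_sum A - B - B)
      ({1..} \<times> {1..})"
    by (intro has_sum_diff A B B')
  then have 1: "((\<lambda>(j, k). coag_term g r j k) has_sum A - B - B) ({1..} \<times> {1..})"
    by (simp add: coag_term_def case_prod_unfold algebra_simps)
  have "((\<lambda>l. g l * ?w l * m) has_sum B) {1..}"
    using B
  proof (rule has_sum_SigmaD)
    show "((\<lambda>k. g (fst (j, k)) * ?W (j, k)) has_sum g j * ?w j * m) {1..}" for j
      using has_sum_cmult_right[OF mom[unfolded has_first_moment_def], of "g j * ?w j"]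
      by (simp add: mult_ac)
  qed
  then have "((\<lambda>l. 2 * (g l * ?w l * m)) has_sum 2 * B) {1..}"
    by (rule has_sum_cmult_right)
  then have "((\<lambda>l. g l * conv r l - 2 * (g l * ?w l * m)) has_sum A - 2 * B) {1..}"
    using A by (intro has_sum_diff has_sum_conv) (simp add: case_prod_unfold)
  then have 2: "((\<lambda>l. g l * conv r l - 2 * m * (g l * ?w l)) has_sum A - B - B) {1..}"
    by (simp add: mult_ac)
  show ?thesis
    using that 1 2 .
qed

text \<open>The reflection k to j - k identifies the contributions of the two fragments.\<close>

lemma frag_term_eq:
  "1 \<le> j \<Longrightarrow> frag_term g r j = g j * ((real j - 1) * r j) - 2 * (\<Sum>k=1..<j. g k * r j)"
proof -
  assume j: "1 \<le> j"
  have "(\<Sum>k=1..<j. g (j - k) * r j) = (\<Sum>k=1..<j. g k * r j)"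
    by (rule sum.reindex_bij_witness[where i = "\<lambda>k. j - k" and j = "\<lambda>k. j - k"]) auto
  moreover have "frag_term g r j =
      (\<Sum>k=1..<j. g j * r j) - (\<Sum>k=1..<j. g k * r j) - (\<Sum>k=1..<j. g (j - k) * r j)"
    by (simp add: frag_term_def left_diff_distrib sum_subtractf)
  moreover have "(\<Sum>k=1..<j. g j * r j) = g j * ((real j - 1) * r j)"
    using j by (simp add: of_nat_diff)
  ultimately show ?thesis
    by simp
qed

text \<open>Exchange the order of summation over pairs k < j: for fixed k the values r(j) with j > k
  add up to the tail. The first moment gives absolute convergence.\<close>

lemma has_sum_frag:
  assumes mom: "has_first_moment r m" and nn: "\<And>l. 1 \<le> l \<Longrightarrow> 0 \<le> r l"
    and g: "\<And>l. 1 \<le> l \<Longrightarrow> \<bar>g l\<bar> \<le> K" and s: "(r has_sum s) {1..}"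
  obtains S where "(frag_term g r has_sum S) {1..}"
    "((\<lambda>l. g l * ((real l - 1) * r l) - 2 * (g l * tail s r l)) has_sum S) {1..}"
proof -
  have G: "(\<lambda>j. (real j - 1) * r j) summable_on {1..}"
    using has_sum_diff[OF mom[unfolded has_first_moment_def] s]
    by (auto simp: left_diff_distrib summable_on_def)
  then have "(\<lambda>j. g j * ((real j - 1) * r j)) summable_on {1..}"
    using nn g by (intro summable_on_bounded_mult[where K = K and f = "\<lambda>j. (real j - 1) * r j"]) auto
  then obtain A where A: "((\<lambda>j. g j * ((real j - 1) * r j)) has_sum A) {1..}"
    by (auto simp: summable_on_def)
  let ?T = "Sigma {1..} (\<lambda>j. {1..<j})"
  \<comment> \<open>Row j consists of j - 1 copies of r(j), so \<open>G\<close> provides summable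
    row sums.\<close>
  have "(\<lambda>(j, k). r j) summable_on ?T"
    by (rule summable_on_SigmaI[OF _ G])
      (use nn in \<open>auto intro!: has_sum_finiteI simp: of_nat_diff\<close>)
  then have "(\<lambda>p. g (snd p) * r (fst p)) summable_on ?T"
    using nn g by (intro summable_on_bounded_mult[where K = K and f = "\<lambda>p. r (fst p)"])
      (auto simp: case_prod_unfold)
  then obtain B where B: "((\<lambda>p. g (snd p) * r (fst p)) has_sum B) ?T"
    by (auto simp: summable_on_def)
  have "((\<lambda>j. \<Sum>k=1..<j. g k * r j) has_sum B) {1..}"
    using B by (rule has_sum_SigmaD) (auto intro!: has_sum_finiteI)
  then have "((\<lambda>j. g j * ((real j - 1) * r j) - 2 * (\<Sum>k=1..<j. g k * r j)) has_sum A - 2 * B) {1..}"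
    by (intro has_sum_diff A has_sum_cmult_right)
  then have 1: "(frag_term g r has_sum A - 2 * B) {1..}"
    by (rule has_sum_cong[THEN iffD1, rotated]) (simp add: frag_term_eq)
  have "((\<lambda>p. g (fst p) * r (snd p)) has_sum B) (Sigma {1..} (\<lambda>k. {k<..}))"
    using B
    by (subst has_sum_reindex_bij_witness[where T = ?T and i = prod.swap and j = prod.swap
          and h = "\<lambda>p. g (snd p) * r (fst p)" and s' = B]) auto
  then have "((\<lambda>k. g k * tail s r k) has_sum B) {1..}"
    by (rule has_sum_SigmaD) (auto intro!: has_sum_cmult_right has_sum_tail s)
  then have 2: "((\<lambda>l. g l * ((real l - 1) * r l) - 2 * (g l * tail s r l)) has_sum A - 2 * B) {1..}"
    by (intro has_sum_diff A has_sum_cmult_right)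
  show ?thesis
    using that 1 2 .
qed

lemma has_first_moment_imp_has_sum:
  assumes "has_first_moment r m" "\<And>l. 1 \<le> l \<Longrightarrow> 0 \<le> r l"
  shows "(r has_sum infsum r {1..}) {1..}"
proof (rule has_sum_infsum, rule summable_on_comparison_test)
  show "(\<lambda>l. real l * r l) summable_on {1..}"
    using assms(1) by (auto simp: has_first_moment_def summable_on_def)
  show "r l \<le> real l * r l" if "l \<in> {1..}" for l
    using that mult_right_mono[of 1 "real l" "r l"] assms(2) by simp
qed (use assms in auto)

text \<open>Twice the weak right-hand side is \<open>g\<close> paired with the defect of
  \<open>balanced\<close>: subtract the regrouped fragmentation series from the regrouped
  coagulation series.\<close>

lemma weak_form:
  assumes mom: "has_first_moment r m" and nn: "\<And>l. 1 \<le> l \<Longrightarrow> 0 \<le> r l"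
    and g: "bounded (g ` {1..})" and s: "(r has_sum s) {1..}"
  shows "weak_sums_converge g r"
    and "((\<lambda>l. g l * (conv r l + 2 * tail s r l - ((2 * m + 1) * real l - 1) * r l))
           has_sum 2 * weak_rhs g r) {1..}"
proof -
  obtain K where K: "\<And>l. 1 \<le> l \<Longrightarrow> \<bar>g l\<bar> \<le> K"
    using g by (auto simp: bounded_iff)
  obtain C where C: "((\<lambda>(j, k). coag_term g r j k) has_sum C) ({1..} \<times> {1..})"
    "((\<lambda>l. g l * conv r l - 2 * m * (g l * (real l * r l))) has_sum C) {1..}"
    using has_sum_coag[of r m g K, OF mom nn K] by blast
  obtain F where F: "(frag_term g r has_sum F) {1..}"
    "((\<lambda>l. g l * ((real l - 1) * r l) - 2 * (g l * tail s r l)) has_sum F) {1..}"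
    using has_sum_frag[of r m g K, OF mom nn K s] by blast
  have inner: "coag_term g r j summable_on {1..}" if "1 \<le> j" for j
    using C(1) that by (intro summable_on_SigmaD1[of "coag_term g r"]) (auto simp: summable_on_def)
  have outer: "((\<lambda>j. \<Sum>\<^sub>\<infinity>k\<in>{1..}. coag_term g r j k) has_sum C) {1..}"
    using C(1) by (rule has_sum_SigmaD) (auto intro!: has_sum_infsum inner simp del: One_nat_def)
  have "(\<lambda>j. g j * r j) summable_on {1..}"
    using nn K s by (intro summable_on_bounded_mult[where K = K]) (auto simp: summable_on_def)
  then show "weak_sums_converge g r"
    using inner outer F(1) by (auto simp: weak_sums_converge_def summable_on_def)
  have rhs: "2 * weak_rhs g r = C - F"
    using outer F(1) by (simp add: weak_rhs_def infsumI)
  show "((\<lambda>l. g l * (conv r l + 2 * tail s r l - ((2 * m + 1) * real l - 1) * r l))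
      has_sum 2 * weak_rhs g r) {1..}"
    unfolding rhs using has_sum_diff[OF C(2) F(2)] by (simp add: algebra_simps)
qed

section \<open>Stationary solutions are solutions of the recursion\<close>

text \<open>For constant \<open>r\<close> the time derivative is 0, so the weak right-hand side must
  vanish for all bounded test functions, which by \<open>weak_form\<close> is the recursion at every
  index.\<close>

lemma stationary_CF_solution_iff:
  assumes mom: "has_first_moment r m" and r: "r \<in> {1..} \<rightarrow>\<^sub>E {0..}"
  shows "stationary_CF_solution r \<longleftrightarrow> (\<forall>l\<ge>1. balanced m (infsum r {1..}) r l)"
proof -
  let ?s = "infsum r {1..}"
  have nn: "0 \<le> r l" if "1 \<le> l" for l
    using r that by (auto simp: PiE_def Pi_def)
  have s: "(r has_sum ?s) {1..}"
    using mom nn by (rule has_first_moment_imp_has_sum)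
  have wf: "weak_sums_converge g r"
    "((\<lambda>l. g l * (conv r l + 2 * tail ?s r l - ((2 * m + 1) * real l - 1) * r l))
       has_sum 2 * weak_rhs g r) {1..}" if "bounded (g ` {1..})" for g
    using weak_form[OF mom nn that s] by blast+
  have "CF_solution (\<lambda>j t. r j) \<longleftrightarrow> (\<forall>g. bounded (g ` {1..}) \<longrightarrow> weak_rhs g r = 0)"
  proof
    assume CF: "CF_solution (\<lambda>j t. r j)"
    show "\<forall>g. bounded (g ` {1..}) \<longrightarrow> weak_rhs g r = 0"
    proof (intro allI impI)
      fix g :: "nat \<Rightarrow> real"
      assume "bounded (g ` {1..})"
      then have "((\<lambda>s. \<Sum>\<^sub>\<infinity>j\<in>{1..}. g j * r j) has_real_derivative weak_rhs g r) (at 1)"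
        using CF unfolding CF_solution_def by (metis zero_less_one)
      then show "weak_rhs g r = 0"
        by (rule DERIV_unique) (rule DERIV_const)
    qed
  next
    assume "\<forall>g. bounded (g ` {1..}) \<longrightarrow> weak_rhs g r = 0"
    then show "CF_solution (\<lambda>j t. r j)"
      using nn wf(1) unfolding CF_solution_def by auto
  qed
  also have "\<dots> \<longleftrightarrow> (\<forall>l\<ge>1. balanced m ?s r l)"
  proof safe
    fix l :: nat
    assume rhs: "\<forall>g. bounded (g ` {1..}) \<longrightarrow> weak_rhs g r = 0" and l: "1 \<le> l"
    \<comment> \<open>The indicator of \<open>l\<close> isolates the defect at
      \<open>l\<close>.\<close>
    define g where "g = (\<lambda>j. of_bool (j = l) :: real)"
    have "bounded (g ` {1..})"
      by (auto simp: bounded_iff g_def intro!: exI[of _ 1])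
    with rhs wf(2)[of g] have "((\<lambda>j. g j * (conv r j + 2 * tail ?s r j
        - ((2 * m + 1) * real j - 1) * r j)) has_sum 0) {1..}"
      by simp
    moreover have "((\<lambda>j. g j * (conv r j + 2 * tail ?s r j - ((2 * m + 1) * real j - 1) * r j))
        has_sum (conv r l + 2 * tail ?s r l - ((2 * m + 1) * real l - 1) * r l)) {1..}"
      using l by (intro has_sum_finite_neutralI[of "{l}"]) (auto simp: g_def)
    ultimately show "balanced m ?s r l"
      unfolding balanced_def using has_sum_unique by fastforce
  next
    fix g :: "nat \<Rightarrow> real"
    assume "\<forall>l\<ge>1. balanced m ?s r l" and g: "bounded (g ` {1..})"
    then have "((\<lambda>l. 0) has_sum 2 * weak_rhs g r) {1::nat..}"
      by (intro has_sum_cong[THEN iffD1, OF _ wf(2)[OF g]]) (auto simp: balanced_def)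
    then show "weak_rhs g r = 0"
      using has_sum_unique has_sum_0 by (metis mult_eq_0_iff zero_neq_numeral)
  qed
  finally show ?thesis
    using r by (simp add: stationary_CF_solution_def)
qed

section \<open>Uniqueness and existence\<close>

lemma conv_cong: "(\<And>i. 1 \<le> i \<Longrightarrow> i < l \<Longrightarrow> r i = r' i) \<Longrightarrow> conv r l = conv r' l"
  by (auto simp: conv_def intro!: sum.cong)

lemma tail_cong: "(\<And>i. 1 \<le> i \<Longrightarrow> i \<le> l \<Longrightarrow> r i = r' i) \<Longrightarrow> tail s r l = tail s r' l"
  by (auto simp: tail_def intro!: sum.cong)

lemma balanced_unique:
  assumes "\<And>l. 1 \<le> l \<Longrightarrow> balanced m s r l" "\<And>l. 1 \<le> l \<Longrightarrow> balanced m s r' l"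
    and "0 < m" "1 \<le> l"
  shows "r l = r' l"
  using \<open>1 \<le> l\<close>
proof (induction l rule: less_induct)
  case (less l)
  have "conv r l = conv r' l" "tail s r (l - 1) = tail s r' (l - 1)"
    using less by (auto intro!: conv_cong tail_cong)
  then show ?case
    using assms(1,2)[OF less.prems] less.prems \<open>0 < m\<close> by (simp add: balanced_iff)
qed

text \<open>The zeroth moment is not prescribed, but the moment identity with M = m fixes it as m^2
  + (1 - 2m)m = m(1 - m).\<close>

lemma stationary_imp_balanced:
  assumes m: "m \<le> 1/2" and stat: "stationary_CF_solution r" and mom: "has_first_moment r m"
    and l: "1 \<le> l"
  shows "balanced m (m * (1 - m)) r l"
proof -
  let ?s = "infsum r {1..}"
  have r: "r \<in> {1..} \<rightarrow>\<^sub>E {0..}"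
    using stat by (simp add: stationary_CF_solution_def)
  then have nn: "0 \<le> r l" if "1 \<le> l" for l
    using that by (auto simp: PiE_def Pi_def)
  have bal: "balanced m ?s r l" if "1 \<le> l" for l
    using stationary_CF_solution_iff[OF mom r] stat that by blast
  have "0 \<le> tail ?s r n" for n
    using has_sum_tail[OF has_first_moment_imp_has_sum[OF mom nn], of n] nn
    by (rule has_sum_nonneg) auto
  then obtain M where M: "has_first_moment r M" "M\<^sup>2 + (1 - 2 * m) * M = ?s"
    using balanced_imp_moments[OF bal nn _ m] by blast
  moreover have "M = m"
    using M(1) mom unfolding has_first_moment_def by (rule has_sum_unique)
  ultimately have "?s = m * (1 - m)"
    by (simp add: power2_eq_square algebra_simps)
  then show ?thesis
    using bal[OF l] by simp
qed

text \<open>In the constructed sequence \<open>m\<close> is at first only a coefficient of the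
  recursion; that it is also the first moment follows from the choice of total.\<close>

lemma stationary_exists:
  assumes m: "0 < m" "m \<le> 1/2"
  shows "\<exists>r. stationary_CF_solution r \<and> has_first_moment r m"
proof -
  let ?s = "m * (1 - m)"
  \<comment> \<open>The restriction makes \<open>r\<close> extensional; its value at index 0 enters
    neither \<open>conv\<close> nor \<open>tail\<close>.\<close>
  define r where "r = restrict (\<lambda>l. ?s * scaled_sol m ?s l) {1..}"
  have r_eq: "r l = ?s * scaled_sol m ?s l" if "1 \<le> l" for l
    using that by (simp add: r_def)
  have tail_eq: "tail ?s r l = tail ?s (\<lambda>l. ?s * scaled_sol m ?s l) l" for l
    by (intro tail_cong r_eq)
  have bal: "balanced m ?s r l" if "1 \<le> l" for l
  proof -
    have "conv r l = conv (\<lambda>l. ?s * scaled_sol m ?s l) l"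
      by (intro conv_cong r_eq)
    then show ?thesis
      using balanced_scaled_sol[OF that m(1), of ?s] that by (simp add: balanced_def tail_eq r_eq)
  qed
  have s: "0 \<le> ?s"
    using m by simp
  have nn: "0 \<le> r l" if "1 \<le> l" for l
    using m s that by (auto simp: r_eq intro!: mult_nonneg_nonneg scaled_sol_nonneg tail_scaled_sol_nonneg)
  have tail: "0 \<le> tail ?s r n" for n
    using m s unfolding tail_eq tail_scaled by (intro mult_nonneg_nonneg tail_scaled_sol_nonneg) auto
  obtain M where s_sum: "(r has_sum ?s) {1..}" and M: "has_first_moment r M" "0 \<le> M" "M\<^sup>2 + (1 - 2 * m) * M = ?s"
    using balanced_imp_moments[OF bal nn tail m(2)] by blast
  \<comment> \<open>The other root m - 1 of the quadratic is negative.\<close>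
  have "(M - m) * (M + (1 - m)) = 0"
    using M(3) by (simp add: power2_eq_square algebra_simps)
  then have "M = m"
    using M(2) m by auto
  with M have mom: "has_first_moment r m" by simp
  have rE: "r \<in> {1..} \<rightarrow>\<^sub>E {0..}"
    using nn by (auto simp: r_def)
  have "infsum r {1..} = ?s"
    using s_sum by (rule infsumI)
  then show ?thesis
    using stationary_CF_solution_iff[OF mom rE] bal mom by auto
qed

theorem lemma5p7:
  fixes m :: real
  assumes "0 < m" and "m \<le> 1/2"
  shows "(\<exists>!r. stationary_CF_solution r \<and> has_first_moment r m) \<and>
         (\<forall>r. stationary_CF_solution r \<and> has_first_moment r m \<longrightarrow>
            (\<forall>l\<ge>1. r l = 2 * m * (1 - m) / ((2 * m + 1) * real l + 1)
               + 1 / ((2 * m + 1) * real l + 1)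
                 * ((\<Sum>i=1..<l. real i * real (l - i) * r i * r (l - i))
                    - 2 * (\<Sum>i=1..<l. r i))))"
proof (intro conjI allI impI; (elim conjE)?)
  note balanced = stationary_imp_balanced[OF assms(2)]
  show "\<exists>!r. stationary_CF_solution r \<and> has_first_moment r m"
  proof (rule ex_ex1I[OF stationary_exists[OF assms]], elim conjE)
    fix r r'
    assume r: "stationary_CF_solution r" "has_first_moment r m"
      and r': "stationary_CF_solution r'" "has_first_moment r' m"
    show "r = r'"
    proof (rule PiE_ext)
      show "r \<in> {1..} \<rightarrow>\<^sub>E {0..}" "r' \<in> {1..} \<rightarrow>\<^sub>E {0..}"
        using r r' by (simp_all add: stationary_CF_solution_def)
      show "r l = r' l" if "l \<in> {1..}" for l
        using balanced_unique[OF balanced[OF r] balanced[OF r'] assms(1)] that by simp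
    qed
  qed
  fix r and l :: nat
  assume "stationary_CF_solution r" "has_first_moment r m" and l: "1 \<le> l"
  then have "r l = (2 * tail (m * (1 - m)) r (l - 1) + conv r l) / ((2 * m + 1) * real l + 1)"
    using balanced assms(1) by (simp add: balanced_iff)
  also have "tail (m * (1 - m)) r (l - 1) = m * (1 - m) - (\<Sum>i=1..<l. r i)"
    using l by (simp add: tail_def atLeastLessThan_eq_pred)
  finally show "r l = 2 * m * (1 - m) / ((2 * m + 1) * real l + 1)
               + 1 / ((2 * m + 1) * real l + 1)
                 * ((\<Sum>i=1..<l. real i * real (l - i) * r i * r (l - i))
                    - 2 * (\<Sum>i=1..<l. r i))"
    by (simp add: conv_def add_divide_distrib diff_divide_distrib algebra_simps)
qed

end
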